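(* Let $f(\cdot;i):\mathbb{R}^d\to\mathbb{R}$, $i\in[n]$, and $F(w)=\frac1n\sum_{i=1}^n f(w;i)$. Assume: (a) $\mathrm{dom}(F)\neq\emptyset$ and $F_*:=\inf_{w\in\mathbb{R}^d}F(w)>-\infty$; (b) there is $L>0$ such that for every $i\in[n]$ and all $w,w'\in\mathrm{dom}(F)$, $\|\nabla f(w;i)-\nabla f(w';i)\|\le L\|w-w'\|$; (c) there is $G>0$ such that $\|\nabla f(w;i)\|\le G$ for all $w\in\mathrm{dom}(F)$ and $i\in[n]$. Let the iterates be generated by the Single Shuffling Momentum Gradient algorithm (described in the context) with momentum weight $0\le\beta<1$ and learning rates $\eta_i^{(t)}:=\frac{\eta_t}{n}$ with $0<\eta_t\le\frac1L$ for $t\ge1$. Then $$\mathbb{E}\big[\|\nabla F(\hat w_T)\|^2\big]\le\frac{\Delta_1}{\big(\sum_{t=1}^T\eta_t\big)(1-\beta^n)}+L^2G^2\left(\frac{\sum_{t=1}^T\xi_t^3}{\sum_{t=1}^T\eta_t}\right)+\frac{4\beta^nG^2}{1-\beta^n},$$ where $\xi_t:=\max(\eta_t,\eta_{t-1})$ for $t\ge2$, $\xi_1:=\eta_1$, and $$\Delta_1:=2[F(\tilde w_0)-F_*]+\left(\frac1L+\eta_1\right)\|\nabla F(\tilde w_0)\|^2+2L\eta_1^2G^2.$$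
   Context: $[n]=\{1,\dots,n\}$; $\|\cdot\|$ is the Euclidean norm; $\mathbb{E}$ is expectation over all randomness (of the permutation, if random, and of the output). Since each $f(\cdot;i)$ is real-valued on $\mathbb{R}^d$, $\mathrm{dom}(F)=\mathbb{R}^d$; each $f(\cdot;i)$ is differentiable. Single Shuffling Momentum Gradient algorithm, with parameters $\beta$, number of epochs $T\ge1$, and $\eta_t$: Choose $\tilde w_0\in\mathbb{R}^d$ (deterministic) and set $\tilde m_0:=0$. Generate one permutation $\pi$ of $[n]$ (arbitrary), used at every epoch. For $t=1,\dots,T$: set $w_0^{(t)}:=\tilde w_{t-1}$, $m_0^{(t)}:=\tilde m_{t-1}$; for $i=0,\dots,n-1$ put $g_i^{(t)}:=\nabla f(w_i^{(t)};\pi(i+1))$ and $$m_{i+1}^{(t)}:=\beta m_i^{(t)}+(1-\beta)g_i^{(t)},\qquad w_{i+1}^{(t)}:=w_i^{(t)}-\tfrac{\eta_t}{n}m_{i+1}^{(t)};$$ then set $\tilde w_t:=w_n^{(t)}$ and $\tilde m_t:=m_n^{(t)}$. Output: $\hat w_T\in\{\tilde w_0,\dots,\tilde w_{T-1}\}$ chosen at random (independently of $\pi$) with probability $\mathbb{P}[\hat w_T=\tilde w_{t-1}]=\eta_t/\sum_{s=1}^T\eta_s$. *)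

theory Defs
  imports "HOL-Probability.Probability"
begin

text \<open>The vector \<open>GRAD f w\<close> is meaningful where \<open>f\<close> is differentiable; it is then unique.\<close>

definition GRAD :: "('a::euclidean_space \<Rightarrow> real) \<Rightarrow> 'a \<Rightarrow> 'a" where
  "GRAD f w = (THE D. GDERIV f w :> D)"

text \<open>The component functions are \<open>f i\<close> with \<open>i \<in> {1..n}\<close>; values of \<open>f\<close> at other indices are
  irrelevant.\<close>

definition avg_loss :: "nat \<Rightarrow> (nat \<Rightarrow> 'a::euclidean_space \<Rightarrow> real) \<Rightarrow> 'a \<Rightarrow> real" where
  "avg_loss n f w = (1 / real n) * (\<Sum>i=1..n. f i w)"

text \<open>\<open>smg_inner f \<beta> \<gamma> p (w\<^sub>0, m\<^sub>0) i\<close> is the pair \<open>(w\<^sub>i, m\<^sub>i)\<close> reached inside one epoch with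
  per-step learning rate \<open>\<gamma>\<close> and permutation \<open>p\<close>.\<close>

primrec smg_inner :: "(nat \<Rightarrow> 'a::euclidean_space \<Rightarrow> real) \<Rightarrow> real \<Rightarrow> real \<Rightarrow> (nat \<Rightarrow> nat)
    \<Rightarrow> 'a \<times> 'a \<Rightarrow> nat \<Rightarrow> 'a \<times> 'a" where
  "smg_inner f \<beta> \<gamma> p wm 0 = wm"
| "smg_inner f \<beta> \<gamma> p wm (Suc i) =
    (let (w, m) = smg_inner f \<beta> \<gamma> p wm i;
         g = GRAD (f (p (i + 1))) w;
         m' = \<beta> *\<^sub>R m + (1 - \<beta>) *\<^sub>R g;
         w' = w - \<gamma> *\<^sub>R m'
     in (w', m'))"

text \<open>\<open>smg_epoch n f \<beta> \<eta> p w\<^sub>0 t\<close> is the pair of the iterate and the momentum after \<open>t\<close> epochs; the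
  momentum is carried over from one epoch to the next, and the same \<open>p\<close> is used in all of them.\<close>

primrec smg_epoch :: "nat \<Rightarrow> (nat \<Rightarrow> 'a::euclidean_space \<Rightarrow> real) \<Rightarrow> real \<Rightarrow> (nat \<Rightarrow> real)
    \<Rightarrow> (nat \<Rightarrow> nat) \<Rightarrow> 'a \<Rightarrow> nat \<Rightarrow> 'a \<times> 'a" where
  "smg_epoch n f \<beta> \<eta> p w0 0 = (w0, 0)"
| "smg_epoch n f \<beta> \<eta> p w0 (Suc t) =
    smg_inner f \<beta> (\<eta> (Suc t) / real n) p (smg_epoch n f \<beta> \<eta> p w0 t) n"

definition smg_iterate :: "nat \<Rightarrow> (nat \<Rightarrow> 'a::euclidean_space \<Rightarrow> real) \<Rightarrow> real \<Rightarrow> (nat \<Rightarrow> real)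
    \<Rightarrow> (nat \<Rightarrow> nat) \<Rightarrow> 'a \<Rightarrow> nat \<Rightarrow> 'a" where
  "smg_iterate n f \<beta> \<eta> p w0 t = fst (smg_epoch n f \<beta> \<eta> p w0 t)"

text \<open>\<open>\<pi>\<close> is the (possibly deterministic, i.e. constant) permutation of \<open>{1..n}\<close>. The output is
  \<open>smg_iterate n f \<beta> \<eta> (\<pi> \<omega>) w0 (\<tau> \<omega> - 1)\<close>, where the index \<open>\<tau>\<close> is independent of \<open>\<pi>\<close>. No law is
  prescribed for \<open>\<pi>\<close>. Independence is stated through the generated sigma-algebras because
  \<open>indep_var\<close> requires both variables to have the same type.\<close>

definition smg_randomness :: "'b measure \<Rightarrow> nat \<Rightarrow> nat \<Rightarrow> (nat \<Rightarrow> real)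
    \<Rightarrow> ('b \<Rightarrow> nat \<Rightarrow> nat) \<Rightarrow> ('b \<Rightarrow> nat) \<Rightarrow> bool" where
  "smg_randomness M n T \<eta> \<pi> \<tau> \<longleftrightarrow>
     prob_space M \<and>
     \<pi> \<in> measurable M (count_space {p. p permutes {1..n}}) \<and>
     \<tau> \<in> measurable M (count_space {1..T}) \<and>
     prob_space.indep_set M
       {\<pi> -` A \<inter> space M |A. A \<subseteq> {p. p permutes {1..n}}}
       {\<tau> -` B \<inter> space M |B. B \<subseteq> {1..T}} \<and>
     (\<forall>t\<in>{1..T}. measure M {\<omega> \<in> space M. \<tau> \<omega> = t} = \<eta> t / (\<Sum>s=1..T. \<eta> s))"

definition smg_xi :: "(nat \<Rightarrow> real) \<Rightarrow> nat \<Rightarrow> real" where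
  "smg_xi \<eta> t = (if t \<ge> 2 then max (\<eta> t) (\<eta> (t - 1)) else \<eta> 1)"

definition smg_Delta :: "nat \<Rightarrow> (nat \<Rightarrow> 'a::euclidean_space \<Rightarrow> real) \<Rightarrow> real \<Rightarrow> real \<Rightarrow> real
    \<Rightarrow> 'a \<Rightarrow> real" where
  "smg_Delta n f L G \<eta>1 w0 =
     2 * (avg_loss n f w0 - (INF w. avg_loss n f w))
     + (1 / L + \<eta>1) * (norm (GRAD (avg_loss n f) w0))\<^sup>2
     + 2 * L * \<eta>1\<^sup>2 * G\<^sup>2"

end

theory Submission
  imports Defs
begin

text \<open>
  Fix a permutation and write \<open>w\<^sub>t\<close> for the iterate after \<open>t\<close> epochs and \<open>v\<^sub>t\<close> for the mean of the
  \<open>n\<close> momentum vectors used in epoch \<open>t\<close>, so that \<open>w\<^sub>t = w\<^sub>t\<^sub>-\<^sub>1 - \<eta>\<^sub>t v\<^sub>t\<close>. Since \<open>\<eta>\<^sub>t \<le> 1 / L\<close>, the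
  quadratic upper bound for the \<open>L\<close>-smooth function \<open>F\<close> gives
  \<open>\<eta>\<^sub>t \<parallel>\<nabla>F w\<^sub>t\<^sub>-\<^sub>1\<parallel>\<^sup>2 + 2 F w\<^sub>t \<le> 2 F w\<^sub>t\<^sub>-\<^sub>1 + \<eta>\<^sub>t \<parallel>\<nabla>F w\<^sub>t\<^sub>-\<^sub>1 - v\<^sub>t\<parallel>\<^sup>2\<close>
  (\<open>epoch_descent\<close>), so everything rests on how well \<open>v\<^sub>t\<close> approximates the full gradient.

  Let \<open>t \<ge> 2\<close>. Unrolling the momentum recursion over two consecutive epochs expresses
  \<open>v\<^sub>t - \<beta>\<^sup>n v\<^sub>t\<^sub>-\<^sub>1\<close> as \<open>1 / n\<close> times a weighted sum of component gradients in which the component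
  visited in step \<open>j\<close> (counted from \<open>0\<close>) occurs with weight \<open>1 - \<beta>\<^sup>n\<^sup>-\<^sup>j\<close> at its point in epoch \<open>t\<close> and
  with weight \<open>\<beta>\<^sup>n\<^sup>-\<^sup>j - \<beta>\<^sup>n\<close> at its point in epoch \<open>t - 1\<close>
  (\<open>momentum_mean_difference\<close>). Because the same permutation is used in both epochs, these two
  weights belong to the same component, and their sum \<open>1 - \<beta>\<^sup>n\<close> does not depend on \<open>j\<close>.
  All the points involved lie within \<open>G \<xi>\<^sub>t\<close> of \<open>w\<^sub>t\<^sub>-\<^sub>1\<close>, so \<open>v\<^sub>t\<close> differs from
  \<open>\<beta>\<^sup>n v\<^sub>t\<^sub>-\<^sub>1 + (1 - \<beta>\<^sup>n) \<nabla>F w\<^sub>t\<^sub>-\<^sub>1\<close> by at most \<open>(1 - \<beta>\<^sup>n) L G \<xi>\<^sub>t\<close> (\<open>momentum_mean_error\<close>). Bounding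
  \<open>\<parallel>\<nabla>F w\<^sub>t\<^sub>-\<^sub>1 - v\<^sub>t\<^sub>-\<^sub>1\<parallel>\<close> crudely by \<open>2 G\<close> and using convexity of the square,
  \<open>\<parallel>\<nabla>F w\<^sub>t\<^sub>-\<^sub>1 - v\<^sub>t\<parallel>\<^sup>2 \<le> 4 \<beta>\<^sup>n G\<^sup>2 + (1 - \<beta>\<^sup>n) L\<^sup>2 G\<^sup>2 \<xi>\<^sub>t\<^sup>2\<close> (\<open>gradient_momentum_gap\<close>).

  The first epoch has no predecessor; there \<open>\<parallel>v\<^sub>1\<parallel> \<le> G\<close> and Young's inequality suffice, which is where
  the terms of \<open>\<Delta>\<^sub>1\<close> other than \<open>2 (F w\<^sub>0 - F\<^sub>*)\<close> come from. Telescoping yields a bound on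
  \<open>\<Sum>\<^sub>t \<eta>\<^sub>t \<parallel>\<nabla>F w\<^sub>t\<^sub>-\<^sub>1\<parallel>\<^sup>2\<close> that is uniform in the permutation, and independence of the output index and
  the permutation turns it into the bound on the expectation.
\<close>

section \<open>Gradients and the quadratic upper bound\<close>

lemma GDERIV_unique:
  fixes f :: "'a::euclidean_space \<Rightarrow> real"
  assumes "GDERIV f w :> D" and "GDERIV f w :> E"
  shows "D = E"
proof -
  have "(\<lambda>h. h \<bullet> D) = (\<lambda>h. h \<bullet> E)"
    using assms unfolding gderiv_def by (rule has_derivative_unique)
  then have "h \<bullet> (D - E) = 0" for h
    by (metis inner_diff_right eq_iff_diff_eq_0)
  then have "(D - E) \<bullet> (D - E) = 0" .
  then show ?thesis by simp
qed

lemma GRAD_eqI: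
  assumes "GDERIV f w :> D"
  shows "GRAD f w = D"
  unfolding GRAD_def using assms by (rule the_equality) (rule GDERIV_unique[OF _ assms])

lemma GDERIV_GRAD:
  fixes f :: "'a::euclidean_space \<Rightarrow> real"
  assumes "f differentiable (at w)"
  shows "GDERIV f w :> GRAD f w"
proof -
  obtain f' where f': "(f has_derivative f') (at w)"
    using assms by (auto simp: differentiable_def)
  define D where "D = (\<Sum>b\<in>Basis. f' b *\<^sub>R b)"
  have lin: "linear f'" using f' by (rule has_derivative_linear)
  have "f' h = h \<bullet> D" for h
  proof -
    have "f' h = f' (\<Sum>b\<in>Basis. (h \<bullet> b) *\<^sub>R b)" by (simp add: euclidean_representation)
    also have "\<dots> = (\<Sum>b\<in>Basis. (h \<bullet> b) * f' b)"
      by (simp add: linear_sum[OF lin] linear_cmul[OF lin])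
    also have "\<dots> = h \<bullet> D" by (simp add: D_def inner_sum_right mult.commute)
    finally show ?thesis .
  qed
  then have "f' = (\<lambda>h. h \<bullet> D)" by auto
  with f' have "GDERIV f w :> D" by (simp add: gderiv_def)
  then show ?thesis using GRAD_eqI by metis
qed

lemma quadratic_upper_bound:
  fixes F :: "'a::euclidean_space \<Rightarrow> real"
  assumes grad: "\<And>w. GDERIV F w :> D w"
    and lip: "\<And>w w'. norm (D w - D w') \<le> L * norm (w - w')"
  shows "F y \<le> F x + (y - x) \<bullet> D x + L / 2 * (norm (y - x))\<^sup>2"
proof -
  define h where "h = y - x"
  \<comment> \<open>The gap in the claimed bound along the segment from \<open>x\<close> to \<open>y\<close>; it does not increase.\<close>
  define \<phi> where "\<phi> s = F (x + s *\<^sub>R h) - s * (h \<bullet> D x) - L / 2 * s\<^sup>2 * (norm h)\<^sup>2" for s :: real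
  have "\<phi> 1 \<le> \<phi> 0"
  proof (rule DERIV_nonpos_imp_nonincreasing[where f = \<phi>])
    fix s :: real assume s: "0 \<le> s" "s \<le> 1"
    let ?d = "h \<bullet> D (x + s *\<^sub>R h) - h \<bullet> D x - L * s * (norm h)\<^sup>2"
    have "((\<lambda>s. F (x + s *\<^sub>R h)) has_derivative (\<lambda>u. (u *\<^sub>R h) \<bullet> D (x + s *\<^sub>R h))) (at s)"
      by (rule has_derivative_compose[where g = F, OF _ grad[unfolded gderiv_def]])
        (auto intro!: derivative_eq_intros)
    moreover have "(\<lambda>u. (u *\<^sub>R h) \<bullet> D (x + s *\<^sub>R h)) = (*) (h \<bullet> D (x + s *\<^sub>R h))"
      by (auto simp: mult.commute)
    ultimately have "((\<lambda>s. F (x + s *\<^sub>R h)) has_real_derivative h \<bullet> D (x + s *\<^sub>R h)) (at s)"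
      by (simp add: has_field_derivative_def)
    then have "(\<phi> has_real_derivative ?d) (at s)"
      unfolding \<phi>_def by (auto intro!: derivative_eq_intros)
    moreover have "?d \<le> 0"
    proof -
      have "h \<bullet> (D (x + s *\<^sub>R h) - D x) \<le> norm h * norm (D (x + s *\<^sub>R h) - D x)"
        by (rule norm_cauchy_schwarz)
      also have "\<dots> \<le> norm h * (L * norm (s *\<^sub>R h))"
        using lip[of "x + s *\<^sub>R h" x] by (intro mult_left_mono) auto
      also have "\<dots> = L * s * (norm h)\<^sup>2" using s by (simp add: power2_eq_square)
      finally show ?thesis by (simp add: inner_diff_right)
    qed
    ultimately show "\<exists>d. (\<phi> has_real_derivative d) (at s) \<and> d \<le> 0" by blast
  qed simp
  then show ?thesis by (simp add: \<phi>_def h_def)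
qed

section \<open>Exponentially weighted averages\<close>

lemma momentum_unroll:
  fixes m g :: "nat \<Rightarrow> 'a::real_vector"
  assumes rec: "\<And>i. m (Suc i) = \<beta> *\<^sub>R m i + (1 - \<beta>) *\<^sub>R g i"
  shows "m k = \<beta> ^ k *\<^sub>R m 0 + (\<Sum>j<k. ((1 - \<beta>) * \<beta> ^ (k - Suc j)) *\<^sub>R g j)"
proof (induction k)
  case 0
  then show ?case by simp
next
  case (Suc k)
  have "\<beta> *\<^sub>R (\<Sum>j<k. ((1 - \<beta>) * \<beta> ^ (k - Suc j)) *\<^sub>R g j)
      = (\<Sum>j<k. ((1 - \<beta>) * \<beta> ^ (Suc k - Suc j)) *\<^sub>R g j)"
    unfolding scaleR_sum_right
  proof (rule sum.cong[OF refl])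
    fix j assume "j \<in> {..<k}"
    then have "Suc k - Suc j = Suc (k - Suc j)" by auto
    then show "\<beta> *\<^sub>R ((1 - \<beta>) * \<beta> ^ (k - Suc j)) *\<^sub>R g j
        = ((1 - \<beta>) * \<beta> ^ (Suc k - Suc j)) *\<^sub>R g j"
      by (metis (no_types, lifting) mult.left_commute power_Suc scaleR_scaleR)
  qed
  then show ?case unfolding rec[of k] Suc.IH by (simp add: scaleR_right_distrib)
qed

lemma momentum_partial_sum:
  fixes m g :: "nat \<Rightarrow> 'a::real_vector"
  assumes rec: "\<And>i. m (Suc i) = \<beta> *\<^sub>R m i + (1 - \<beta>) *\<^sub>R g i"
  shows "(\<Sum>i<k. m (Suc i)) = (\<Sum>i<k. \<beta> ^ Suc i) *\<^sub>R m 0 + (\<Sum>j<k. (1 - \<beta> ^ (k - j)) *\<^sub>R g j)"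
proof (induction k)
  case 0
  then show ?case by simp
next
  case (Suc k)
  have "(\<Sum>j<Suc k. (1 - \<beta> ^ (Suc k - j)) *\<^sub>R g j)
      = (\<Sum>j<Suc k. (1 - \<beta> ^ (k - j)) *\<^sub>R g j + ((1 - \<beta>) * \<beta> ^ (Suc k - Suc j)) *\<^sub>R g j)"
  proof (rule sum.cong[OF refl])
    fix j assume "j \<in> {..<Suc k}"
    then have "Suc k - j = Suc (k - j)" by auto
    then show "(1 - \<beta> ^ (Suc k - j)) *\<^sub>R g j
        = (1 - \<beta> ^ (k - j)) *\<^sub>R g j + ((1 - \<beta>) * \<beta> ^ (Suc k - Suc j)) *\<^sub>R g j"
      by (simp add: scaleR_left_distrib[symmetric] algebra_simps)
  qed
  also have "\<dots> = (\<Sum>j<k. (1 - \<beta> ^ (k - j)) *\<^sub>R g j)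
      + (\<Sum>j<Suc k. ((1 - \<beta>) * \<beta> ^ (Suc k - Suc j)) *\<^sub>R g j)"
    by (simp add: sum.distrib)
  finally show ?case
    using Suc.IH momentum_unroll[of m \<beta> g "Suc k", OF rec]
    by (simp add: scaleR_left_distrib)
qed

text \<open>Two consecutive passes of length \<open>n\<close>, the second starting from the final momentum of the first.
  The momentum left over from before the first pass cancels.\<close>

lemma momentum_sum_difference:
  fixes m m' g g' :: "nat \<Rightarrow> 'a::real_vector"
  assumes rec: "\<And>i. m (Suc i) = \<beta> *\<^sub>R m i + (1 - \<beta>) *\<^sub>R g i"
    and rec': "\<And>i. m' (Suc i) = \<beta> *\<^sub>R m' i + (1 - \<beta>) *\<^sub>R g' i"
    and start: "m' 0 = m n"
  shows "(\<Sum>i<n. m' (Suc i)) - \<beta> ^ n *\<^sub>R (\<Sum>i<n. m (Suc i))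
    = (\<Sum>j<n. (1 - \<beta> ^ (n - j)) *\<^sub>R g' j + (\<beta> ^ (n - j) - \<beta> ^ n) *\<^sub>R g j)"
proof -
  define B where "B = (\<Sum>i<n. \<beta> ^ Suc i)"
  have "B = \<beta> * (\<Sum>i<n. \<beta> ^ i)" by (simp add: B_def sum_distrib_left)
  then have B: "B * (1 - \<beta>) = \<beta> * (1 - \<beta> ^ n)"
    by (simp add: one_diff_power_eq[of \<beta> n])
  have left: "B *\<^sub>R (m' 0 - \<beta> ^ n *\<^sub>R m 0) = (\<Sum>j<n. ((1 - \<beta> ^ n) * \<beta> ^ (n - j)) *\<^sub>R g j)"
  proof -
    have "B *\<^sub>R (m' 0 - \<beta> ^ n *\<^sub>R m 0) = (\<Sum>j<n. (B * ((1 - \<beta>) * \<beta> ^ (n - Suc j))) *\<^sub>R g j)"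
      unfolding start using momentum_unroll[of m \<beta> g n, OF rec] by (simp add: scaleR_sum_right)
    also have "\<dots> = (\<Sum>j<n. ((1 - \<beta> ^ n) * \<beta> ^ (n - j)) *\<^sub>R g j)"
    proof (rule sum.cong[OF refl])
      fix j assume "j \<in> {..<n}"
      then have "n - j = Suc (n - Suc j)" by auto
      then have "B * ((1 - \<beta>) * \<beta> ^ (n - Suc j)) = (1 - \<beta> ^ n) * \<beta> ^ (n - j)"
        using B by (simp add: mult.assoc[symmetric])
      then show "(B * ((1 - \<beta>) * \<beta> ^ (n - Suc j))) *\<^sub>R g j
          = ((1 - \<beta> ^ n) * \<beta> ^ (n - j)) *\<^sub>R g j" by simp
    qed
    finally show ?thesis .
  qed
  have "(\<Sum>i<n. m' (Suc i)) - \<beta> ^ n *\<^sub>R (\<Sum>i<n. m (Suc i))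
      = B *\<^sub>R (m' 0 - \<beta> ^ n *\<^sub>R m 0) + (\<Sum>j<n. (1 - \<beta> ^ (n - j)) *\<^sub>R g' j)
        - \<beta> ^ n *\<^sub>R (\<Sum>j<n. (1 - \<beta> ^ (n - j)) *\<^sub>R g j)"
    unfolding momentum_partial_sum[of m \<beta> g n, OF rec] momentum_partial_sum[of m' \<beta> g' n, OF rec']
      B_def[symmetric]
    by (simp add: algebra_simps)
  also have "\<dots> = (\<Sum>j<n. ((1 - \<beta> ^ n) * \<beta> ^ (n - j)) *\<^sub>R g j + (1 - \<beta> ^ (n - j)) *\<^sub>R g' j
      - (\<beta> ^ n * (1 - \<beta> ^ (n - j))) *\<^sub>R g j)"
    unfolding left by (simp add: sum.distrib sum_subtractf scaleR_sum_right)
  also have "\<dots> = (\<Sum>j<n. (1 - \<beta> ^ (n - j)) *\<^sub>R g' j + (\<beta> ^ (n - j) - \<beta> ^ n) *\<^sub>R g j)"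
    by (rule sum.cong[OF refl]) (simp add: algebra_simps)
  finally show ?thesis .
qed

lemma square_convex_combination:
  fixes b x y :: real
  assumes "0 \<le> b" and "b \<le> 1"
  shows "(b * x + (1 - b) * y)\<^sup>2 \<le> b * x\<^sup>2 + (1 - b) * y\<^sup>2"
proof -
  have "b * x\<^sup>2 + (1 - b) * y\<^sup>2 - (b * x + (1 - b) * y)\<^sup>2 = b * (1 - b) * (x - y)\<^sup>2"
    by (simp add: power2_eq_square algebra_simps)
  also have "\<dots> \<ge> 0" using assms by simp
  finally show ?thesis by simp
qed

section \<open>The iteration with a fixed permutation\<close>

text \<open>One run of the algorithm along the permutation \<open>p\<close>. The epochs are numbered from \<open>0\<close> here, so that epoch \<open>t\<close> uses the learning rate \<open>\<eta> (Suc t)\<close>.\<close>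

locale smg_run =
  fixes f :: "nat \<Rightarrow> 'a::euclidean_space \<Rightarrow> real"
    and n :: nat
    and L G \<beta> :: real
    and \<eta> :: "nat \<Rightarrow> real"
    and p :: "nat \<Rightarrow> nat"
    and w0 :: 'a
  assumes n: "n \<ge> 1"
    and diff: "\<And>i w. i \<in> {1..n} \<Longrightarrow> f i differentiable (at w)"
    and L: "L > 0"
    and smooth: "\<And>i w w'. i \<in> {1..n} \<Longrightarrow> norm (GRAD (f i) w - GRAD (f i) w') \<le> L * norm (w - w')"
    and G: "G > 0"
    and grad_bound: "\<And>i w. i \<in> {1..n} \<Longrightarrow> norm (GRAD (f i) w) \<le> G"
    and \<beta>: "0 \<le> \<beta>" "\<beta> < 1"
    and rate: "\<And>t. t \<ge> 1 \<Longrightarrow> 0 < \<eta> t \<and> \<eta> t \<le> 1 / L"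
    and perm: "p permutes {1..n}"
begin

abbreviation F :: "'a \<Rightarrow> real" where
  "F \<equiv> avg_loss n f"

text \<open>The point after \<open>i\<close> steps of epoch \<open>t\<close>.\<close>

definition W :: "nat \<Rightarrow> nat \<Rightarrow> 'a" where
  "W t i = fst (smg_inner f \<beta> (\<eta> (Suc t) / n) p (smg_epoch n f \<beta> \<eta> p w0 t) i)"

text \<open>The momentum after \<open>i\<close> steps of epoch \<open>t\<close>.\<close>

definition m :: "nat \<Rightarrow> nat \<Rightarrow> 'a" where
  "m t i = snd (smg_inner f \<beta> (\<eta> (Suc t) / n) p (smg_epoch n f \<beta> \<eta> p w0 t) i)"

text \<open>The component gradient that enters the momentum in step \<open>i\<close> of epoch \<open>t\<close>.\<close>

definition g :: "nat \<Rightarrow> nat \<Rightarrow> 'a" where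
  "g t i = GRAD (f (p (i + 1))) (W t i)"

text \<open>The mean momentum of epoch \<open>t\<close>, which is the effective descent direction of the epoch.\<close>

definition v :: "nat \<Rightarrow> 'a" where
  "v t = (1 / real n) *\<^sub>R (\<Sum>i<n. m t (Suc i))"

lemma m_Suc: "m t (Suc i) = \<beta> *\<^sub>R m t i + (1 - \<beta>) *\<^sub>R g t i"
  by (simp add: m_def g_def W_def Let_def case_prod_beta)

lemma W_Suc: "W t (Suc i) = W t i - (\<eta> (Suc t) / n) *\<^sub>R m t (Suc i)"
  by (simp add: m_def W_def Let_def case_prod_beta)

lemma m_next_epoch: "m (Suc t) 0 = m t n"
  by (simp add: m_def)

lemma W_next_epoch: "W (Suc t) 0 = W t n"
  by (simp add: W_def)

lemma W_iterate: "W t 0 = smg_iterate n f \<beta> \<eta> p w0 t"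
  by (simp add: W_def smg_iterate_def)

lemma W_start: "W 0 0 = w0"
  by (simp add: W_def)

lemma m_start: "m 0 0 = 0"
  by (simp add: m_def)

lemma perm_index: "i < n \<Longrightarrow> p (i + 1) \<in> {1..n}"
  unfolding permutes_in_image[OF perm] by simp

lemma W_epoch: "W (Suc t) 0 = W t 0 - \<eta> (Suc t) *\<^sub>R v t"
proof -
  have "W t k = W t 0 - (\<eta> (Suc t) / n) *\<^sub>R (\<Sum>i<k. m t (Suc i))" for k
    by (induction k) (auto simp: W_Suc scaleR_right_distrib)
  from this[of n] show ?thesis by (simp add: v_def W_next_epoch)
qed

lemma GDERIV_F: "GDERIV F w :> (1 / real n) *\<^sub>R (\<Sum>i=1..n. GRAD (f i) w)"
proof -
  have "((\<lambda>w. \<Sum>i=1..n. f i w) has_derivative (\<lambda>h. \<Sum>i=1..n. h \<bullet> GRAD (f i) w)) (at w)"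
    by (rule has_derivative_sum) (rule GDERIV_GRAD[OF diff, unfolded gderiv_def])
  then have "((\<lambda>w. (1 / real n) * (\<Sum>i=1..n. f i w)) has_derivative
      (\<lambda>h. (1 / real n) * (\<Sum>i=1..n. h \<bullet> GRAD (f i) w))) (at w)"
    by (rule has_derivative_mult_right)
  then show ?thesis
    by (simp only: gderiv_def avg_loss_def[abs_def] inner_scaleR_right inner_sum_right)
qed

lemma GRAD_F: "GRAD F w = (1 / real n) *\<^sub>R (\<Sum>i=1..n. GRAD (f i) w)"
  by (rule GRAD_eqI[OF GDERIV_F])

lemma GRAD_F_shuffled: "GRAD F w = (1 / real n) *\<^sub>R (\<Sum>i<n. GRAD (f (p (i + 1))) w)"
proof -
  have "(\<Sum>i=1..n. GRAD (f i) w) = (\<Sum>i=1..n. GRAD (f (p i)) w)"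
    using sum.permute[OF perm, of "\<lambda>i. GRAD (f i) w"] by (simp add: o_def)
  also have "\<dots> = (\<Sum>i<n. GRAD (f (p (i + 1))) w)"
    by (rule sum.reindex_bij_witness[of _ Suc "\<lambda>i. i - 1"]) auto
  finally show ?thesis by (simp add: GRAD_F)
qed

lemma norm_mean_le:
  assumes "\<And>i. i < n \<Longrightarrow> norm (x i :: 'a) \<le> C"
  shows "norm ((1 / real n) *\<^sub>R (\<Sum>i<n. x i)) \<le> C"
proof -
  have "norm (\<Sum>i<n. x i) \<le> real n * C"
    using sum_norm_le[of "{..<n}" x "\<lambda>_. C"] assms by simp
  then show ?thesis using n by (simp add: field_simps)
qed

lemma norm_GRAD_F: "norm (GRAD F w) \<le> G"
  unfolding GRAD_F_shuffled by (rule norm_mean_le) (rule grad_bound[OF perm_index])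

lemma GRAD_F_lipschitz: "norm (GRAD F w - GRAD F w') \<le> L * norm (w - w')"
proof -
  have "GRAD F w - GRAD F w'
      = (1 / real n) *\<^sub>R (\<Sum>i<n. GRAD (f (p (i + 1))) w - GRAD (f (p (i + 1))) w')"
    by (simp only: GRAD_F_shuffled scaleR_right_diff_distrib sum_subtractf)
  also have "norm \<dots> \<le> L * norm (w - w')"
    by (rule norm_mean_le) (rule smooth[OF perm_index])
  finally show ?thesis .
qed

lemma F_upper_bound: "F y \<le> F x + (y - x) \<bullet> GRAD F x + L / 2 * (norm (y - x))\<^sup>2"
  by (rule quadratic_upper_bound[OF _ GRAD_F_lipschitz]) (rule GDERIV_F[folded GRAD_F])

lemma norm_m: "i \<le> n \<Longrightarrow> norm (m t i) \<le> G"
proof -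
  have step: "norm (m t i) \<le> G" if m0: "norm (m t 0) \<le> G" and "i \<le> n" for t i
    using that(2)
  proof (induction i)
    case 0
    then show ?case using m0 by simp
  next
    case (Suc i)
    have "norm (m t (Suc i)) \<le> \<beta> * norm (m t i) + (1 - \<beta>) * norm (g t i)"
      unfolding m_Suc using \<beta> norm_triangle_ineq[of "\<beta> *\<^sub>R m t i" "(1 - \<beta>) *\<^sub>R g t i"] by simp
    also have "\<dots> \<le> \<beta> * G + (1 - \<beta>) * G"
      using \<beta> Suc grad_bound[OF perm_index] by (intro add_mono mult_left_mono) (auto simp: g_def)
    finally show ?case by (simp add: algebra_simps)
  qed
  have "norm (m t 0) \<le> G"
    using G by (induction t) (auto simp: m_start m_next_epoch intro: step)
  then show "i \<le> n \<Longrightarrow> norm (m t i) \<le> G" by (rule step)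
qed

lemma norm_v: "norm (v t) \<le> G"
  unfolding v_def by (rule norm_mean_le) (rule norm_m, simp)

lemma norm_W_diff:
  assumes "i \<le> j" and "j \<le> n"
  shows "norm (W t j - W t i) \<le> \<eta> (Suc t) * G"
proof -
  have \<eta>: "0 < \<eta> (Suc t)" using rate[of "Suc t"] by simp
  have "norm (W t j - W t i) \<le> real (j - i) * (\<eta> (Suc t) / n * G)" using assms
  proof (induction rule: dec_induct)
    case base
    then show ?case by simp
  next
    case (step j)
    have "norm (W t (Suc j) - W t i)
        \<le> norm (W t j - W t i) + norm ((\<eta> (Suc t) / n) *\<^sub>R m t (Suc j))"
      using norm_triangle_ineq4[of "W t j - W t i" "(\<eta> (Suc t) / n) *\<^sub>R m t (Suc j)"]
      by (simp add: W_Suc algebra_simps)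
    also have "norm ((\<eta> (Suc t) / n) *\<^sub>R m t (Suc j)) = \<eta> (Suc t) / n * norm (m t (Suc j))"
      using \<eta> by simp
    also have "\<dots> \<le> \<eta> (Suc t) / n * G"
      using \<eta> norm_m[of "Suc j" t] step by (intro mult_left_mono) auto
    also have "norm (W t j - W t i) \<le> real (j - i) * (\<eta> (Suc t) / n * G)"
      using step by simp
    finally have "norm (W t (Suc j) - W t i)
        \<le> real (j - i) * (\<eta> (Suc t) / n * G) + \<eta> (Suc t) / n * G" by simp
    moreover have "real (Suc j - i) = real (j - i) + 1" using step by (simp add: Suc_diff_le)
    ultimately show ?case by (simp only: distrib_right mult_1)
  qed
  also have "\<dots> \<le> real n * (\<eta> (Suc t) / n * G)"
    using assms \<eta> G by (intro mult_right_mono) auto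
  also have "\<dots> = \<eta> (Suc t) * G" using n by simp
  finally show ?thesis .
qed

section \<open>The mean momentum of an epoch against the full gradient\<close>

lemma momentum_mean_difference:
  "v (Suc t) - \<beta> ^ n *\<^sub>R v t = (1 / real n) *\<^sub>R
    (\<Sum>j<n. (1 - \<beta> ^ (n - j)) *\<^sub>R g (Suc t) j + (\<beta> ^ (n - j) - \<beta> ^ n) *\<^sub>R g t j)"
  unfolding momentum_sum_difference[where m = "m t" and m' = "m (Suc t)", OF m_Suc m_Suc m_next_epoch,
      symmetric]
  by (simp add: v_def scaleR_right_diff_distrib)

lemma xi_Suc_Suc: "smg_xi \<eta> (Suc (Suc t)) = max (\<eta> (Suc (Suc t))) (\<eta> (Suc t))"
  by (simp add: smg_xi_def)

lemma momentum_mean_error: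
  "norm (v (Suc t) - \<beta> ^ n *\<^sub>R v t - (1 - \<beta> ^ n) *\<^sub>R GRAD F (W (Suc t) 0))
    \<le> (1 - \<beta> ^ n) * (L * (G * smg_xi \<eta> (Suc (Suc t))))"
proof -
  define \<xi> where "\<xi> = smg_xi \<eta> (Suc (Suc t))"
  define h where "h j = GRAD (f (p (j + 1))) (W (Suc t) 0)" for j
  have "v (Suc t) - \<beta> ^ n *\<^sub>R v t - (1 - \<beta> ^ n) *\<^sub>R GRAD F (W (Suc t) 0) = (1 / real n) *\<^sub>R
      (\<Sum>j<n. (1 - \<beta> ^ (n - j)) *\<^sub>R g (Suc t) j + (\<beta> ^ (n - j) - \<beta> ^ n) *\<^sub>R g t j
        - (1 - \<beta> ^ n) *\<^sub>R h j)"
    unfolding momentum_mean_difference GRAD_F_shuffled h_def[symmetric] sum_subtractf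
      scaleR_sum_right[symmetric] scaleR_right_diff_distrib
    by (simp add: mult.commute)
  also have "norm \<dots> \<le> (1 - \<beta> ^ n) * (L * (G * \<xi>))"
  proof (rule norm_mean_le)
    fix j assume j: "j < n"
    have "norm (g (Suc t) j - h j) \<le> L * norm (W (Suc t) j - W (Suc t) 0)"
      unfolding g_def h_def by (rule smooth[OF perm_index[OF j]])
    also have "\<dots> \<le> L * (\<eta> (Suc (Suc t)) * G)"
      using L j by (intro mult_left_mono norm_W_diff) auto
    also have "\<dots> \<le> L * (G * \<xi>)"
      using L G by (simp add: \<xi>_def xi_Suc_Suc mult.commute)
    finally have cur: "norm (g (Suc t) j - h j) \<le> L * (G * \<xi>)" .
    \<comment> \<open>\<open>h j\<close> is taken at the start of epoch \<open>Suc t\<close>, which is the end of epoch \<open>t\<close>.\<close>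
    have "norm (g t j - h j) \<le> L * norm (W t j - W t n)"
      unfolding g_def h_def W_next_epoch by (rule smooth[OF perm_index[OF j]])
    also have "\<dots> \<le> L * (\<eta> (Suc t) * G)"
      unfolding norm_minus_commute[of "W t j"]
      using L j by (intro mult_left_mono norm_W_diff) auto
    also have "\<dots> \<le> L * (G * \<xi>)"
      using L G by (simp add: \<xi>_def xi_Suc_Suc mult.commute)
    finally have prev: "norm (g t j - h j) \<le> L * (G * \<xi>)" .
    have weights: "0 \<le> 1 - \<beta> ^ (n - j)" "0 \<le> \<beta> ^ (n - j) - \<beta> ^ n"
      using \<beta> by (auto simp: power_le_one intro!: power_decreasing)
    have "(1 - \<beta> ^ (n - j)) *\<^sub>R g (Suc t) j + (\<beta> ^ (n - j) - \<beta> ^ n) *\<^sub>R g t j - (1 - \<beta> ^ n) *\<^sub>R h j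
        = (1 - \<beta> ^ (n - j)) *\<^sub>R (g (Suc t) j - h j) + (\<beta> ^ (n - j) - \<beta> ^ n) *\<^sub>R (g t j - h j)"
      by (simp add: algebra_simps)
    also have "norm \<dots> \<le> (1 - \<beta> ^ (n - j)) * norm (g (Suc t) j - h j)
        + (\<beta> ^ (n - j) - \<beta> ^ n) * norm (g t j - h j)"
      by (rule order_trans[OF norm_triangle_ineq]) (use weights in simp)
    also have "\<dots> \<le> (1 - \<beta> ^ (n - j)) * (L * (G * \<xi>)) + (\<beta> ^ (n - j) - \<beta> ^ n) * (L * (G * \<xi>))"
      by (intro add_mono mult_left_mono cur prev weights)
    also have "\<dots> = (1 - \<beta> ^ n) * (L * (G * \<xi>))" by (simp add: algebra_simps)
    finally show "norm ((1 - \<beta> ^ (n - j)) *\<^sub>R g (Suc t) j + (\<beta> ^ (n - j) - \<beta> ^ n) *\<^sub>R g t j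
        - (1 - \<beta> ^ n) *\<^sub>R h j) \<le> (1 - \<beta> ^ n) * (L * (G * \<xi>))" .
  qed
  finally show ?thesis by (simp add: \<xi>_def)
qed

lemma gradient_momentum_gap:
  "(norm (GRAD F (W (Suc t) 0) - v (Suc t)))\<^sup>2
    \<le> 4 * \<beta> ^ n * G\<^sup>2 + (1 - \<beta> ^ n) * (L\<^sup>2 * G\<^sup>2 * (smg_xi \<eta> (Suc (Suc t)))\<^sup>2)"
proof -
  define b where "b = \<beta> ^ n"
  define y where "y = L * (G * smg_xi \<eta> (Suc (Suc t)))"
  let ?D = "GRAD F (W (Suc t) 0)"
  have b: "0 \<le> b" "b \<le> 1" using \<beta> by (auto simp: b_def power_le_one)
  have "?D - v (Suc t) = b *\<^sub>R (?D - v t) - (v (Suc t) - b *\<^sub>R v t - (1 - b) *\<^sub>R ?D)"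
    by (simp add: algebra_simps)
  then have "norm (?D - v (Suc t))
      \<le> norm (b *\<^sub>R (?D - v t)) + norm (v (Suc t) - b *\<^sub>R v t - (1 - b) *\<^sub>R ?D)"
    by (metis norm_triangle_ineq4)
  also have "norm (b *\<^sub>R (?D - v t)) \<le> b * (2 * G)"
  proof -
    have "norm (?D - v t) \<le> 2 * G"
      using norm_triangle_ineq4[of ?D "v t"] norm_GRAD_F[of "W (Suc t) 0"] norm_v[of t] by simp
    then show ?thesis using b by (simp add: mult_left_mono)
  qed
  also have "norm (v (Suc t) - b *\<^sub>R v t - (1 - b) *\<^sub>R ?D) \<le> (1 - b) * y"
    using momentum_mean_error by (simp add: b_def y_def)
  finally have "norm (?D - v (Suc t)) \<le> b * (2 * G) + (1 - b) * y" by simp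
  then have "(norm (?D - v (Suc t)))\<^sup>2 \<le> (b * (2 * G) + (1 - b) * y)\<^sup>2"
    by (intro power_mono) auto
  also have "\<dots> \<le> b * (2 * G)\<^sup>2 + (1 - b) * y\<^sup>2"
    by (rule square_convex_combination[OF b])
  finally show ?thesis by (simp add: b_def y_def power_mult_distrib mult.assoc)
qed

section \<open>Descent and telescoping\<close>

lemma epoch_descent:
  "\<eta> (Suc t) * (norm (GRAD F (W t 0)))\<^sup>2 + 2 * F (W (Suc t) 0)
    \<le> 2 * F (W t 0) + \<eta> (Suc t) * (norm (GRAD F (W t 0) - v t))\<^sup>2"
proof -
  define e where "e = \<eta> (Suc t)"
  let ?D = "GRAD F (W t 0)"
  have e: "0 < e" "e \<le> 1 / L" using rate[of "Suc t"] by (auto simp: e_def)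
  have "F (W (Suc t) 0) \<le> F (W t 0) - e * (v t \<bullet> ?D) + L / 2 * e\<^sup>2 * (norm (v t))\<^sup>2"
    using F_upper_bound[of "W (Suc t) 0" "W t 0"] e
    by (simp add: W_epoch e_def[symmetric] power_mult_distrib)
  moreover have "L * e\<^sup>2 * (norm (v t))\<^sup>2 \<le> e * (norm (v t))\<^sup>2"
  proof (rule mult_right_mono)
    have "L * e \<le> 1" using e L by (simp add: field_simps)
    then have "L * e * e \<le> 1 * e" using e by (intro mult_right_mono) auto
    then show "L * e\<^sup>2 \<le> e" by (simp add: power2_eq_square mult.assoc)
  qed simp
  moreover have "e * (norm (?D - v t))\<^sup>2
      = e * (norm ?D)\<^sup>2 - 2 * (e * (v t \<bullet> ?D)) + e * (norm (v t))\<^sup>2"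
    by (simp add: power2_norm_eq_inner inner_diff_left inner_diff_right inner_commute algebra_simps)
  ultimately show ?thesis unfolding e_def[symmetric] by linarith
qed

text \<open>For the first epoch the gap between gradient and momentum does not become small with \<open>\<eta> 1\<close>,
  because the momentum starts at \<open>0\<close>.\<close>

lemma first_epoch_descent:
  "\<eta> 1 * (norm (GRAD F w0))\<^sup>2 + 2 * F (W 1 0)
    \<le> 2 * F w0 + (1 / L + \<eta> 1) * (norm (GRAD F w0))\<^sup>2 + 2 * L * (\<eta> 1)\<^sup>2 * G\<^sup>2"
proof -
  define e where "e = \<eta> 1"
  let ?D = "GRAD F w0"
  have e: "0 < e" using rate[of 1] by (simp add: e_def)
  have W1: "W 1 0 = w0 - e *\<^sub>R v 0" using W_epoch[of 0] by (simp add: W_start e_def)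
  have "F (W 1 0) \<le> F w0 - e * (v 0 \<bullet> ?D) + L / 2 * e\<^sup>2 * (norm (v 0))\<^sup>2"
    unfolding W1 using F_upper_bound[of "w0 - e *\<^sub>R v 0" w0] e by (simp add: power_mult_distrib)
  moreover have "L * e\<^sup>2 * (norm (v 0))\<^sup>2 \<le> L * e\<^sup>2 * G\<^sup>2"
    using L norm_v[of 0] by (intro mult_left_mono power_mono) auto
  moreover have "- (2 * (e * (v 0 \<bullet> ?D))) \<le> 1 / L * (norm ?D)\<^sup>2 + L * e\<^sup>2 * (norm (v 0))\<^sup>2"
  proof -
    \<comment> \<open>Young's inequality, as the square of a norm.\<close>
    have "0 \<le> (norm (?D + (L * e) *\<^sub>R v 0))\<^sup>2 / L" using L by simp
    also have "\<dots> = 1 / L * (norm ?D)\<^sup>2 + 2 * (e * (v 0 \<bullet> ?D)) + L * e\<^sup>2 * (norm (v 0))\<^sup>2"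
      unfolding power2_norm_eq_inner using L
      by (simp add: inner_add_left inner_add_right inner_commute field_simps power2_eq_square)
    finally show ?thesis by linarith
  qed
  ultimately show ?thesis unfolding e_def[symmetric] by (simp add: distrib_right)
qed

lemma xi_ge: "1 \<le> t \<Longrightarrow> \<eta> t \<le> smg_xi \<eta> t"
  by (cases "t = 1") (auto simp: smg_xi_def)

lemma telescoped_descent:
  "(\<Sum>t=1..Suc k. \<eta> t * (norm (GRAD F (W (t - 1) 0)))\<^sup>2) + 2 * F (W (Suc k) 0)
    \<le> 2 * F w0 + (1 / L + \<eta> 1) * (norm (GRAD F w0))\<^sup>2 + 2 * L * (\<eta> 1)\<^sup>2 * G\<^sup>2
      + (\<Sum>t=1..Suc k. L\<^sup>2 * G\<^sup>2 * smg_xi \<eta> t ^ 3 + 4 * \<beta> ^ n * G\<^sup>2 * \<eta> t)"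
proof (induction k)
  case 0
  have "0 \<le> L\<^sup>2 * G\<^sup>2 * smg_xi \<eta> 1 ^ 3 + 4 * \<beta> ^ n * G\<^sup>2 * \<eta> 1"
    using rate[of 1] \<beta> by (auto simp: smg_xi_def)
  then show ?case using first_epoch_descent by (simp add: W_start)
next
  case (Suc k)
  let ?e = "\<eta> (Suc (Suc k))" and ?\<xi> = "smg_xi \<eta> (Suc (Suc k))"
  have e: "0 < ?e" "?e \<le> ?\<xi>" using rate[of "Suc (Suc k)"] xi_ge[of "Suc (Suc k)"] by auto
  have b: "0 \<le> \<beta> ^ n" "\<beta> ^ n \<le> 1" using \<beta> by (auto simp: power_le_one)
  have "?e * (norm (GRAD F (W (Suc k) 0) - v (Suc k)))\<^sup>2
      \<le> ?e * (4 * \<beta> ^ n * G\<^sup>2 + (1 - \<beta> ^ n) * (L\<^sup>2 * G\<^sup>2 * ?\<xi>\<^sup>2))"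
    using e by (intro mult_left_mono gradient_momentum_gap) auto
  also have "\<dots> = 4 * \<beta> ^ n * G\<^sup>2 * ?e + (1 - \<beta> ^ n) * ?e * (L\<^sup>2 * G\<^sup>2 * ?\<xi>\<^sup>2)"
    by (simp add: algebra_simps)
  also have "(1 - \<beta> ^ n) * ?e * (L\<^sup>2 * G\<^sup>2 * ?\<xi>\<^sup>2) \<le> 1 * ?\<xi> * (L\<^sup>2 * G\<^sup>2 * ?\<xi>\<^sup>2)"
    using e b by (intro mult_right_mono mult_mono) auto
  also have "\<dots> = L\<^sup>2 * G\<^sup>2 * ?\<xi> ^ 3" by (simp add: power2_eq_square power3_eq_cube)
  finally show ?case using Suc.IH epoch_descent[of "Suc k"] by simp
qed

text \<open>The denominators \<open>1 - \<beta>\<^sup>n\<close> only weaken the bound.\<close>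

lemma weighted_gradient_bound:
  assumes bdd: "bdd_below (range F)" and "T \<ge> 1"
  shows "(\<Sum>t=1..T. \<eta> t / (\<Sum>s=1..T. \<eta> s)
        * (norm (GRAD F (smg_iterate n f \<beta> \<eta> p w0 (t - 1))))\<^sup>2)
    \<le> smg_Delta n f L G (\<eta> 1) w0 / ((\<Sum>t=1..T. \<eta> t) * (1 - \<beta> ^ n))
      + L\<^sup>2 * G\<^sup>2 * ((\<Sum>t=1..T. (smg_xi \<eta> t) ^ 3) / (\<Sum>t=1..T. \<eta> t))
      + 4 * \<beta> ^ n * G\<^sup>2 / (1 - \<beta> ^ n)"
proof -
  define S where "S = (\<Sum>t=1..T. \<eta> t)"
  define X where "X = (\<Sum>t=1..T. smg_xi \<eta> t ^ 3)"
  define \<Delta> where "\<Delta> = smg_Delta n f L G (\<eta> 1) w0"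
  define Q where "Q = (\<Sum>t=1..T. \<eta> t * (norm (GRAD F (smg_iterate n f \<beta> \<eta> p w0 (t - 1))))\<^sup>2)"
  have S: "S > 0" unfolding S_def using rate \<open>T \<ge> 1\<close> by (intro sum_pos) auto
  have "\<beta> ^ n < 1" using \<beta> n by (simp add: power_less_one_iff)
  then have b: "0 < 1 - \<beta> ^ n" "1 - \<beta> ^ n \<le> 1" using \<beta> by auto
  have inf: "(INF w. F w) \<le> F w" for w using bdd by (intro cINF_lower) auto
  have \<Delta>: "0 \<le> \<Delta>"
    unfolding \<Delta>_def smg_Delta_def using inf[of w0] L rate[of 1] by (intro add_nonneg_nonneg) auto
  have "Q + 2 * F (W T 0) \<le> 2 * F w0 + (1 / L + \<eta> 1) * (norm (GRAD F w0))\<^sup>2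
      + 2 * L * (\<eta> 1)\<^sup>2 * G\<^sup>2 + (L\<^sup>2 * G\<^sup>2 * X + 4 * \<beta> ^ n * G\<^sup>2 * S)"
    using telescoped_descent[of "T - 1"] \<open>T \<ge> 1\<close>
    by (simp add: W_iterate Q_def X_def S_def sum.distrib sum_distrib_left)
  then have "Q \<le> \<Delta> + L\<^sup>2 * G\<^sup>2 * X + 4 * \<beta> ^ n * G\<^sup>2 * S"
    using inf[of "W T 0"] unfolding \<Delta>_def smg_Delta_def by argo
  then have "Q / S \<le> (\<Delta> + L\<^sup>2 * G\<^sup>2 * X + 4 * \<beta> ^ n * G\<^sup>2 * S) / S"
    using S by (intro divide_right_mono) auto
  also have "\<dots> = \<Delta> / S + L\<^sup>2 * G\<^sup>2 * (X / S) + 4 * \<beta> ^ n * G\<^sup>2"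
    using S by (simp add: add_divide_distrib)
  also have "\<dots> \<le> \<Delta> / (S * (1 - \<beta> ^ n)) + L\<^sup>2 * G\<^sup>2 * (X / S) + 4 * \<beta> ^ n * G\<^sup>2 / (1 - \<beta> ^ n)"
  proof (intro add_mono order_refl)
    show "\<Delta> / S \<le> \<Delta> / (S * (1 - \<beta> ^ n))"
      using \<Delta> S b by (intro divide_left_mono) (auto simp: mult_le_cancel_left1)
    show "4 * \<beta> ^ n * G\<^sup>2 \<le> 4 * \<beta> ^ n * G\<^sup>2 / (1 - \<beta> ^ n)"
      using b \<beta> mult_left_mono[OF b(2), of "4 * \<beta> ^ n * G\<^sup>2"] by (simp add: pos_le_divide_eq)
  qed
  finally show ?thesis
    by (simp add: Q_def S_def X_def \<Delta>_def sum_divide_distrib)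
qed

end

section \<open>Averaging over the permutation and the output index\<close>

lemma (in prob_space) expectation_indep_finite:
  fixes h :: "'c \<Rightarrow> 'd \<Rightarrow> real"
  assumes X: "X \<in> measurable M (count_space A)" and Y: "Y \<in> measurable M (count_space B)"
    and fin: "finite A" "finite B"
    and indep: "indep_set {X -` S \<inter> space M |S. S \<subseteq> A} {Y -` S \<inter> space M |S. S \<subseteq> B}"
  shows "(\<integral>\<omega>. h (X \<omega>) (Y \<omega>) \<partial>M)
    = (\<Sum>a\<in>A. prob {\<omega> \<in> space M. X \<omega> = a} * (\<Sum>b\<in>B. prob {\<omega> \<in> space M. Y \<omega> = b} * h a b))"
proof -
  define EvX where "EvX a = {\<omega> \<in> space M. X \<omega> = a}" for a
  define EvY where "EvY b = {\<omega> \<in> space M. Y \<omega> = b}" for b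
  have EvX: "EvX a = X -` {a} \<inter> space M" and EvY: "EvY b = Y -` {b} \<inter> space M" for a b
    by (auto simp: EvX_def EvY_def)
  have meas: "EvX a \<in> sets M" if "a \<in> A" for a
    unfolding EvX using X that by (intro measurable_sets[of X M "count_space A"]) auto
  have meas': "EvY b \<in> sets M" if "b \<in> B" for b
    unfolding EvY using Y that by (intro measurable_sets[of Y M "count_space B"]) auto
  have "(\<integral>\<omega>. h (X \<omega>) (Y \<omega>) \<partial>M)
      = (\<integral>\<omega>. (\<Sum>a\<in>A. \<Sum>b\<in>B. indicator (EvX a \<inter> EvY b) \<omega> * h a b) \<partial>M)"
  proof (rule Bochner_Integration.integral_cong[OF refl])
    fix \<omega> assume \<omega>: "\<omega> \<in> space M"
    then have mem: "X \<omega> \<in> A" "Y \<omega> \<in> B"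
      using measurable_space[OF X] measurable_space[OF Y] by auto
    have "(\<Sum>a\<in>A. \<Sum>b\<in>B. indicator (EvX a \<inter> EvY b) \<omega> * h a b)
        = (\<Sum>a\<in>A. \<Sum>b\<in>B. if b = Y \<omega> then (if a = X \<omega> then h a b else 0) else 0)"
      using \<omega> by (intro sum.cong refl) (auto simp: EvX_def EvY_def)
    also have "\<dots> = h (X \<omega>) (Y \<omega>)" using fin mem by simp
    finally show "h (X \<omega>) (Y \<omega>) = (\<Sum>a\<in>A. \<Sum>b\<in>B. indicator (EvX a \<inter> EvY b) \<omega> * h a b)" by simp
  qed
  also have "\<dots> = (\<Sum>a\<in>A. \<Sum>b\<in>B. prob (EvX a \<inter> EvY b) * h a b)"
  proof -
    have int: "integrable M (\<lambda>\<omega>. indicator (EvX a \<inter> EvY b) \<omega> * h a b)" if "a \<in> A" "b \<in> B" for a b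
      using meas[OF that(1)] meas'[OF that(2)]
      by (intro integrable_mult_left integrable_real_indicator) (auto simp: less_top[symmetric])
    have val: "(\<integral>\<omega>. indicator (EvX a \<inter> EvY b) \<omega> * h a b \<partial>M) = prob (EvX a \<inter> EvY b) * h a b"
      if "a \<in> A" "b \<in> B" for a b
      using meas[OF that(1)] meas'[OF that(2)] by simp
    have "(\<integral>\<omega>. (\<Sum>a\<in>A. \<Sum>b\<in>B. indicator (EvX a \<inter> EvY b) \<omega> * h a b) \<partial>M)
        = (\<Sum>a\<in>A. \<integral>\<omega>. (\<Sum>b\<in>B. indicator (EvX a \<inter> EvY b) \<omega> * h a b) \<partial>M)"
      by (intro Bochner_Integration.integral_sum Bochner_Integration.integrable_sum int)
    also have "\<dots> = (\<Sum>a\<in>A. \<Sum>b\<in>B. \<integral>\<omega>. indicator (EvX a \<inter> EvY b) \<omega> * h a b \<partial>M)"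
      by (intro sum.cong refl Bochner_Integration.integral_sum int)
    also have "\<dots> = (\<Sum>a\<in>A. \<Sum>b\<in>B. prob (EvX a \<inter> EvY b) * h a b)"
      by (intro sum.cong refl val)
    finally show ?thesis .
  qed
  also have "\<dots> = (\<Sum>a\<in>A. \<Sum>b\<in>B. prob (EvX a) * (prob (EvY b) * h a b))"
  proof (intro sum.cong refl)
    fix a b assume "a \<in> A" "b \<in> B"
    then have "prob (EvX a \<inter> EvY b) = prob (EvX a) * prob (EvY b)"
      unfolding EvX EvY by (intro indep_setD[OF indep]) auto
    then show "prob (EvX a \<inter> EvY b) * h a b = prob (EvX a) * (prob (EvY b) * h a b)" by simp
  qed
  finally show ?thesis by (simp add: EvX_def EvY_def sum_distrib_left)
qed

lemma (in prob_space) prob_sum_values: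
  assumes X: "X \<in> measurable M (count_space A)" and fin: "finite A"
  shows "(\<Sum>a\<in>A. prob {\<omega> \<in> space M. X \<omega> = a}) = 1"
proof -
  have "(\<Sum>a\<in>A. prob {\<omega> \<in> space M. X \<omega> = a}) = prob (\<Union>a\<in>A. {\<omega> \<in> space M. X \<omega> = a})"
  proof (rule finite_measure_finite_Union[symmetric, OF fin])
    have "{\<omega> \<in> space M. X \<omega> = a} = X -` {a} \<inter> space M" for a by auto
    then show "(\<lambda>a. {\<omega> \<in> space M. X \<omega> = a}) ` A \<subseteq> events"
      using measurable_sets[OF X] by auto
  qed (auto simp: disjoint_family_on_def)
  also have "(\<Union>a\<in>A. {\<omega> \<in> space M. X \<omega> = a}) = space M"
    using measurable_space[OF X] by auto
  finally show ?thesis by (simp add: prob_space)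
qed

theorem theorem3:
  fixes f :: "nat \<Rightarrow> 'a::euclidean_space \<Rightarrow> real"
    and n T :: nat
    and L G \<beta> :: real
    and \<eta> :: "nat \<Rightarrow> real"
    and w0 :: 'a
    and M :: "'b measure"
    and \<pi> :: "'b \<Rightarrow> nat \<Rightarrow> nat"
    and \<tau> :: "'b \<Rightarrow> nat"
  assumes "n \<ge> 1" and "T \<ge> 1"
    and diff: "\<And>i w. i \<in> {1..n} \<Longrightarrow> f i differentiable (at w)"
    and bdd: "bdd_below (range (avg_loss n f))"
    and "L > 0"
    and smooth: "\<And>i w w'. i \<in> {1..n} \<Longrightarrow> norm (GRAD (f i) w - GRAD (f i) w') \<le> L * norm (w - w')"
    and "G > 0"
    and grad_bound: "\<And>i w. i \<in> {1..n} \<Longrightarrow> norm (GRAD (f i) w) \<le> G"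
    and "0 \<le> \<beta>" and "\<beta> < 1"
    and rate: "\<And>t. t \<ge> 1 \<Longrightarrow> 0 < \<eta> t \<and> \<eta> t \<le> 1 / L"
    and rand: "smg_randomness M n T \<eta> \<pi> \<tau>"
  shows "(\<integral>\<omega>. (norm (GRAD (avg_loss n f) (smg_iterate n f \<beta> \<eta> (\<pi> \<omega>) w0 (\<tau> \<omega> - 1))))\<^sup>2 \<partial>M)
    \<le> smg_Delta n f L G (\<eta> 1) w0 / ((\<Sum>t=1..T. \<eta> t) * (1 - \<beta> ^ n))
      + L\<^sup>2 * G\<^sup>2 * ((\<Sum>t=1..T. (smg_xi \<eta> t) ^ 3) / (\<Sum>t=1..T. \<eta> t))
      + 4 * \<beta> ^ n * G\<^sup>2 / (1 - \<beta> ^ n)"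
proof -
  define P where "P = {p. p permutes {1..n}}"
  define h where "h p t = (norm (GRAD (avg_loss n f) (smg_iterate n f \<beta> \<eta> p w0 (t - 1))))\<^sup>2" for p t
  define R where "R = smg_Delta n f L G (\<eta> 1) w0 / ((\<Sum>t=1..T. \<eta> t) * (1 - \<beta> ^ n))
      + L\<^sup>2 * G\<^sup>2 * ((\<Sum>t=1..T. (smg_xi \<eta> t) ^ 3) / (\<Sum>t=1..T. \<eta> t))
      + 4 * \<beta> ^ n * G\<^sup>2 / (1 - \<beta> ^ n)"
  interpret prob_space M using rand by (simp add: smg_randomness_def)
  have \<pi>: "\<pi> \<in> measurable M (count_space P)" and \<tau>: "\<tau> \<in> measurable M (count_space {1..T})"
    and indep: "indep_set {\<pi> -` A \<inter> space M |A. A \<subseteq> P} {\<tau> -` B \<inter> space M |B. B \<subseteq> {1..T}}"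
    and law: "\<And>t. t \<in> {1..T} \<Longrightarrow> prob {\<omega> \<in> space M. \<tau> \<omega> = t} = \<eta> t / (\<Sum>s=1..T. \<eta> s)"
    using rand unfolding smg_randomness_def P_def by auto
  have fin: "finite P" unfolding P_def by (simp add: finite_permutations)
  have bound: "(\<Sum>t\<in>{1..T}. prob {\<omega> \<in> space M. \<tau> \<omega> = t} * h p t) \<le> R" if "p \<in> P" for p
  proof -
    have perm: "p permutes {1..n}" using that by (simp add: P_def)
    interpret smg_run f n L G \<beta> \<eta> p w0
      by unfold_locales fact+
    show ?thesis
      using weighted_gradient_bound[OF bdd \<open>T \<ge> 1\<close>] by (simp add: law h_def R_def)
  qed
  have "(\<integral>\<omega>. h (\<pi> \<omega>) (\<tau> \<omega>) \<partial>M) = (\<Sum>p\<in>P. prob {\<omega> \<in> space M. \<pi> \<omega> = p}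
      * (\<Sum>t\<in>{1..T}. prob {\<omega> \<in> space M. \<tau> \<omega> = t} * h p t))"
    by (rule expectation_indep_finite[OF \<pi> \<tau> fin _ indep]) simp
  also have "\<dots> \<le> (\<Sum>p\<in>P. prob {\<omega> \<in> space M. \<pi> \<omega> = p} * R)"
    by (intro sum_mono mult_left_mono bound) auto
  also have "\<dots> = R"
    using prob_sum_values[OF \<pi> fin] by (simp add: sum_distrib_right[symmetric])
  finally show ?thesis by (simp add: h_def R_def)
qed

end
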